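(* Let $p$ be a prime, $A:=\mathbb{F}_p((t))$ (additive group) and $\alpha\colon A\to A$, $f\mapsto tf$. For $s=(s_n)_{n\in\mathbb{N}}\in\{0,1\}^{\mathbb{N}}$ define $\eta_s\colon A\times A\to A$ by $$\eta_s(x,y):=\sum_{n=1}^\infty s_nt^n\omega_{2n}(x,y)\quad\text{for }x,y\in A,$$ where $\omega_n(x,y):=\sum_{i}x_iy_{i+n}t^i$ for $x=\sum_ix_it^i$, $y=\sum_jy_jt^j$. Then the contraction groups $(A\times_{\eta_s}A,\alpha\times\alpha)$ for $s\in\{0,1\}^{\mathbb{N}}$ are pairwise not isomorphic. Thus, if $r,s\in\{0,1\}^{\mathbb{N}}$ and there exists an isomorphism $\psi\colon A\times_{\eta_s}A\to A\times_{\eta_r}A$ of topological groups such that $(\alpha\times\alpha)\circ\psi=\psi\circ(\alpha\times\alpha)$, then $r=s$. In particular, the map $$\{0,1\}^{\mathbb{N}}\to H^2_{\mathrm{eq}}(A,A),\quad s\mapsto[\eta_s]$$ is injective.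
   Context: $\mathbb{N}=\{1,2,\ldots\}$. $\mathbb{F}_p((t))$ is the field of formal Laurent series over $\mathbb{F}_p=\mathbb{Z}/p\mathbb{Z}$ with its usual locally compact topology; its elements are $x=\sum_{i\geq i_0}x_it^i$ with $i_0\in\mathbb{Z}$, $x_i\in\mathbb{F}_p$, and $x_i:=0$ for $i<i_0$. The $s_n\in\{0,1\}$ are regarded as elements of $\mathbb{F}_p$. A locally compact contraction group is a pair $(G,\beta)$ where $G$ is a locally compact group and $\beta$ a bicontinuous automorphism of $G$ with $\beta^n(x)\to e$ as $n\to\infty$ for all $x\in G$. Isomorphisms of contraction groups are isomorphisms of topological groups intertwining the given automorphisms. $Z^2_{\mathrm{eq}}(A,A)$ (with respect to the trivial action of $A$ on $A$) is the group, under pointwise addition, of all continuous maps $\omega\colon A\times A\to A$ satisfying $\omega(y,z)-\omega(x+y,z)+\omega(x,y+z)-\omega(x,y)=0$ and $\omega(tx,ty)=t\omega(x,y)$ for all $x,y,z\in A$. $B^2_{\mathrm{eq}}(A,A)$ is the subgroup of all maps $(x,y)\mapsto f(x)+f(y)-f(x+y)$ with $f\colon A\to A$ continuous such that $f(tx)=tf(x)$ for all $x\in A$. $H^2_{\mathrm{eq}}(A,A):=Z^2_{\mathrm{eq}}(A,A)/B^2_{\mathrm{eq}}(A,A)$ and $[\omega]$ is the class of $\omega$. The maps $\eta_s$ are elements of $Z^2_{\mathrm{eq}}(A,A)$ (they are continuous, biadditive and equivariant). For $\omega\in Z^2_{\mathrm{eq}}(A,A)$, $A\times_\omega A$ is $A\times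 A$ with the product topology and the multiplication $(a_1,b_1)(a_2,b_2)=(a_1+a_2+\omega(b_1,b_2),b_1+b_2)$; it is a locally compact group for which $\alpha\times\alpha$ is a contractive automorphism. *)

theory Defs
  imports
    "HOL-Analysis.Analysis"
    "HOL-Algebra.Coset"
    "HOL-Computational_Algebra.Formal_Laurent_Series"
    "Berlekamp_Zassenhaus.Finite_Field"
begin

record 'a topgroup = "'a monoid" +
  gtop :: "'a topology"

definition topological_group :: "'a topgroup \<Rightarrow> bool" where
  "topological_group G \<longleftrightarrow>
     group G \<and> topspace (gtop G) = carrier G \<and>
     continuous_map (prod_topology (gtop G) (gtop G)) (gtop G) (\<lambda>(x, y). x \<otimes>\<^bsub>G\<^esub> y) \<and>
     continuous_map (gtop G) (gtop G) (\<lambda>x. inv\<^bsub>G\<^esub> x)"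

definition locally_compact_group :: "'a topgroup \<Rightarrow> bool" where
  "locally_compact_group G \<longleftrightarrow>
     topological_group G \<and> Hausdorff_space (gtop G) \<and> locally_compact_space (gtop G)"

definition topgroup_iso :: "'a topgroup \<Rightarrow> 'b topgroup \<Rightarrow> ('a \<Rightarrow> 'b) set" where
  "topgroup_iso G H = {\<psi>. \<psi> \<in> iso G H \<and> homeomorphic_map (gtop G) (gtop H) \<psi>}"

definition contraction_group :: "'a topgroup \<times> ('a \<Rightarrow> 'a) \<Rightarrow> bool" where
  "contraction_group = (\<lambda>(G, \<beta>).
     locally_compact_group G \<and> \<beta> \<in> topgroup_iso G G \<and>
     (\<forall>x\<in>carrier G. limitin (gtop G) (\<lambda>n. (\<beta> ^^ n) x) \<one>\<^bsub>G\<^esub> sequentially))"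

definition contraction_group_isos ::
    "'a topgroup \<times> ('a \<Rightarrow> 'a) \<Rightarrow> 'b topgroup \<times> ('b \<Rightarrow> 'b) \<Rightarrow> ('a \<Rightarrow> 'b) set" where
  "contraction_group_isos = (\<lambda>(G, \<beta>) (H, \<gamma>).
     {\<psi>. \<psi> \<in> topgroup_iso G H \<and> (\<forall>x\<in>carrier G. \<gamma> (\<psi> x) = \<psi> (\<beta> x))})"

definition contraction_isomorphic ::
    "'a topgroup \<times> ('a \<Rightarrow> 'a) \<Rightarrow> 'b topgroup \<times> ('b \<Rightarrow> 'b) \<Rightarrow> bool" where
  "contraction_isomorphic X Y \<longleftrightarrow> contraction_group_isos X Y \<noteq> {}"

text \<open>The field $\mathbb{F}_p((t))$, where $p$ is the cardinality of the index type, which the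
  class \<^class>\<open>prime_card\<close> requires to be prime. Its topology is the $t$-adic one of the
  metric space instance for \<^typ>\<open>'a fls\<close>, and $t$ is \<^const>\<open>fls_X\<close>.\<close>

type_synonym 'p laurent = "'p mod_ring fls"

definition \<alpha> :: "'p::prime_card laurent \<Rightarrow> 'p laurent" where
  "\<alpha> f = fls_X * f"

definition Z2eq_set :: "('p::prime_card laurent \<times> 'p laurent \<Rightarrow> 'p laurent) set" where
  "Z2eq_set = {\<omega>. continuous_on UNIV \<omega> \<and>
     (\<forall>x y z. \<omega> (y, z) - \<omega> (x + y, z) + \<omega> (x, y + z) - \<omega> (x, y) = 0) \<and>
     (\<forall>x y. \<omega> (fls_X * x, fls_X * y) = fls_X * \<omega> (x, y))}"

definition Z2eq :: "('p::prime_card laurent \<times> 'p laurent \<Rightarrow> 'p laurent) monoid" where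
  "Z2eq = \<lparr>carrier = Z2eq_set, mult = (\<lambda>\<omega> \<omega>' z. \<omega> z + \<omega>' z), one = (\<lambda>z. 0)\<rparr>"

definition B2eq :: "('p::prime_card laurent \<times> 'p laurent \<Rightarrow> 'p laurent) set" where
  "B2eq = {(\<lambda>(x, y). f x + f y - f (x + y)) | f.
     continuous_on UNIV f \<and> (\<forall>x. f (fls_X * x) = fls_X * f x)}"

definition H2eq :: "('p::prime_card laurent \<times> 'p laurent \<Rightarrow> 'p laurent) set monoid" where
  "H2eq = Z2eq Mod B2eq"

definition H2eq_class ::
    "('p::prime_card laurent \<times> 'p laurent \<Rightarrow> 'p laurent) \<Rightarrow>
     ('p laurent \<times> 'p laurent \<Rightarrow> 'p laurent) set" where
  "H2eq_class \<omega> = B2eq #>\<^bsub>Z2eq\<^esub> \<omega>"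

text \<open>The neutral element of the extension is $(0,0)$ since equivariance forces
  $\omega(0,0) = t\,\omega(0,0)$, hence $\omega(0,0) = 0$.\<close>

definition ext_group ::
    "('p::prime_card laurent \<times> 'p laurent \<Rightarrow> 'p laurent) \<Rightarrow>
     ('p laurent \<times> 'p laurent) topgroup" where
  "ext_group \<omega> =
     \<lparr>carrier = UNIV,
      mult = (\<lambda>(a1, b1) (a2, b2). (a1 + a2 + \<omega> (b1, b2), b1 + b2)),
      one = (0, 0),
      gtop = prod_topology euclidean euclidean\<rparr>"

lift_definition omega :: "nat \<Rightarrow> 'a::mult_zero fls \<Rightarrow> 'a fls \<Rightarrow> 'a fls"
  is "\<lambda>n x y i. x i * y (i + int n)"
  by (auto elim: eventually_mono)

definition binary_seqs :: "(nat \<Rightarrow> nat) set" where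
  "binary_seqs = ({1..} \<rightarrow>\<^sub>E {0, 1})"

text \<open>The series converges $t$-adically; it runs over $n \ge 1$, written as \<^term>\<open>Suc k\<close>.\<close>

definition eta ::
    "(nat \<Rightarrow> nat) \<Rightarrow> 'p::prime_card laurent \<times> 'p laurent \<Rightarrow> 'p laurent" where
  "eta s = (\<lambda>(x, y). \<Sum>k. let n = Suc k in
     fls_const (of_nat (s n)) * fls_X ^ n * omega (2 * n) x y)"

end

theory Submission
  imports Defs
begin

text \<open>
  Two elements of the extension by \<open>\<omega>\<close> commute iff \<open>\<omega>\<close> is symmetric on their second
  components. In particular \<open>g = (0, 1)\<close> commutes with its translate \<open>(0, t\<^sup>2\<^sup>n)\<close> iff
  \<open>s\<^sub>n = 0\<close>, and an equivariant isomorphism \<open>\<psi>\<close> respects this relation between \<open>g\<close> and its translate.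
  If \<open>v\<close> is the second component of \<open>\<psi> g\<close> and \<open>v\<^sub>k\<close> its leading coefficient, the commutator of
  \<open>\<psi> g\<close> and its translate has the coefficient \<open>r\<^sub>n v\<^sub>k\<^sup>2\<close> at \<open>t\<^sup>k\<^sup>+\<^sup>n\<close>, so \<open>s\<^sub>n = 0\<close> implies
  \<open>r\<^sub>n = 0\<close> as soon as \<open>v \<noteq> 0\<close>. If \<open>v = 0\<close> then \<open>g\<close> is central, which forces \<open>s = 0\<close>; both
  groups are then abelian and \<open>r = 0\<close>. For the cohomology classes it is enough that coboundaries
  are symmetric.
\<close>

unbundle fps_syntax

section \<open>The topology of formal Laurent series\<close>

text \<open>The distance is 2 to the power of minus the order of \<open>x - y\<close>, so being
  strictly below \<open>inverse (2 ^ n)\<close> means order greater than \<open>n\<close>. If the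
  order is negative, the distance exceeds 1 and both sides fail.\<close>

lemma dist_fls_less_iff:
  fixes x y :: "'a::group_add fls"
  shows "dist x y < inverse (2 ^ n) \<longleftrightarrow> (\<forall>i\<le>int n. x $$ i = y $$ i)"
proof (cases "x = y")
  case False
  then have ne: "x - y \<noteq> 0" by simp
  have "(\<forall>i\<le>int n. x $$ i = y $$ i) \<longleftrightarrow> (\<forall>i\<le>int n. (x - y) $$ i = 0)"
    by simp
  also have "\<dots> \<longleftrightarrow> int n < fls_subdegree (x - y)"
    using nth_fls_subdegree_nonzero[OF ne] fls_subdegree_greaterI[OF ne, of "int n"]
    by (metis fls_eq0_below_subdegree linorder_not_le order_le_less_trans)
  also have "\<dots> \<longleftrightarrow> dist x y < inverse (2 ^ n)"
  proof (cases "fls_subdegree (x - y) \<ge> 0")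
    case True
    then show ?thesis
      using False by (auto simp: dist_fls_def)
  next
    case neg: False
    have "inverse (2 ^ n) \<le> (1::real)"
      by (simp add: field_simps)
    also have "1 \<le> (2::real) ^ nat (- fls_subdegree (x - y))"
      by simp
    finally show ?thesis
      using False neg by (simp add: dist_fls_def)
  qed
  finally show ?thesis by simp
qed auto

lemma open_fls_iff:
  fixes U :: "'a::group_add fls set"
  shows "open U \<longleftrightarrow> (\<forall>x\<in>U. \<exists>N. \<forall>y. (\<forall>i<N. y $$ i = x $$ i) \<longrightarrow> y \<in> U)"
    (is "_ \<longleftrightarrow> (\<forall>x\<in>U. ?P x)")
proof -
  have "(\<exists>e>0. \<forall>y. dist y x < e \<longrightarrow> y \<in> U) \<longleftrightarrow> ?P x" for x
  proof
    assume "\<exists>e>0. \<forall>y. dist y x < e \<longrightarrow> y \<in> U"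
    then obtain e where e: "e > 0" "\<And>y. dist y x < e \<Longrightarrow> y \<in> U" by blast
    obtain n where "inverse (2 ^ n) < e"
      using real_arch_pow_inv[OF e(1), of "1/2"] by (auto simp: power_one_over field_simps)
    then have "y \<in> U" if "\<forall>i<int n + 1. y $$ i = x $$ i" for y
      using that dist_fls_less_iff[of y x n] e(2)[of y] by force
    then show "?P x" by blast
  next
    assume "?P x"
    then obtain N where N: "\<And>y. (\<forall>i<N. y $$ i = x $$ i) \<Longrightarrow> y \<in> U" by blast
    have "y \<in> U" if "dist y x < inverse (2 ^ nat N)" for y
      using that N[of y] unfolding dist_fls_less_iff by auto
    then show "\<exists>e>0. \<forall>y. dist y x < e \<longrightarrow> y \<in> U"
      by (intro exI[of _ "inverse (2 ^ nat N)"]) simp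
  qed
  then show ?thesis
    by (simp add: open_dist)
qed

text \<open>Series agreeing with \<open>l\<close> below \<open>N\<close> form an open neighbourhood
  base at \<open>l\<close>. All later limits and continuity proofs thereby become coefficient
  comparisons.\<close>

lemma tendsto_fls_iff:
  fixes l :: "'a::group_add fls"
  shows "(f \<longlongrightarrow> l) F \<longleftrightarrow> (\<forall>N. \<forall>\<^sub>F z in F. \<forall>i<N. f z $$ i = l $$ i)"
proof
  assume l: "(f \<longlongrightarrow> l) F"
  show "\<forall>N. \<forall>\<^sub>F z in F. \<forall>i<N. f z $$ i = l $$ i"
  proof
    fix N
    have "open {y. \<forall>i<N. y $$ i = l $$ i}"
      unfolding open_fls_iff by (intro ballI exI[of _ N]) auto
    then show "\<forall>\<^sub>F z in F. \<forall>i<N. f z $$ i = l $$ i"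
      using topological_tendstoD[OF l] by fastforce
  qed
next
  assume *: "\<forall>N. \<forall>\<^sub>F z in F. \<forall>i<N. f z $$ i = l $$ i"
  show "(f \<longlongrightarrow> l) F"
  proof (rule topological_tendstoI)
    fix S assume "open S" "l \<in> S"
    then obtain N where N: "\<And>y. (\<forall>i<N. y $$ i = l $$ i) \<Longrightarrow> y \<in> S"
      unfolding open_fls_iff by blast
    show "\<forall>\<^sub>F z in F. f z \<in> S"
      using *[rule_format, of N] by (rule eventually_mono) (use N in blast)
  qed
qed

text \<open>This makes \<open>continuous_intros\<close> available for the group operations of the
  extensions.\<close>

instance fls :: (ab_group_add) topological_ab_group_add
proof
  fix a b :: "'a fls"
  show "((\<lambda>z. fst z + snd z) \<longlongrightarrow> a + b) (nhds a \<times>\<^sub>F nhds b)"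
    unfolding tendsto_fls_iff
  proof
    fix N
    have "((\<lambda>z. fst z) \<longlongrightarrow> a) (nhds a \<times>\<^sub>F nhds b)" "((\<lambda>z. snd z) \<longlongrightarrow> b) (nhds a \<times>\<^sub>F nhds b)"
      by (simp_all add: filterlim_fst filterlim_snd)
    then have "\<forall>\<^sub>F z in nhds a \<times>\<^sub>F nhds b. \<forall>i<N. fst z $$ i = a $$ i"
      "\<forall>\<^sub>F z in nhds a \<times>\<^sub>F nhds b. \<forall>i<N. snd z $$ i = b $$ i"
      unfolding tendsto_fls_iff by blast+
    then show "\<forall>\<^sub>F z in nhds a \<times>\<^sub>F nhds b. \<forall>i<N. (fst z + snd z) $$ i = (a + b) $$ i"
      by eventually_elim simp
  qed
  have "((\<lambda>z. z) \<longlongrightarrow> a) (nhds a)"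
    by (simp add: filterlim_ident)
  then have "\<forall>\<^sub>F z in nhds a. \<forall>i<N. z $$ i = a $$ i" for N
    unfolding tendsto_fls_iff by blast
  then show "(uminus \<longlongrightarrow> - a) (nhds a)"
    unfolding tendsto_fls_iff by (auto elim!: eventually_mono)
qed

lemma continuous_on_fls_shift [continuous_intros]:
  fixes f :: "'b::topological_space \<Rightarrow> 'a::group_add fls"
  assumes "continuous_on S f"
  shows "continuous_on S (\<lambda>z. fls_shift m (f z))"
  unfolding continuous_on_def tendsto_fls_iff
proof safe
  fix z N assume "z \<in> S"
  then have "\<forall>\<^sub>F w in at z within S. \<forall>i<N + m. f w $$ i = f z $$ i"
    using assms unfolding continuous_on_def tendsto_fls_iff by blast
  then show "\<forall>\<^sub>F w in at z within S. \<forall>i<N. fls_shift m (f w) $$ i = fls_shift m (f z) $$ i"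
    by eventually_elim simp
qed

section \<open>Local compactness\<close>

lemma compact_fls_vanishing_below:
  "compact {f :: 'a::{finite,group_add} fls. \<forall>i<d. f $$ i = 0}"
proof -
  \<comment> \<open>By Tychonoff \<open>X\<close> is compact; the set in question is its image under
    the continuous map \<open>F\<close>, which reads a sequence as the coefficients from index
    \<open>d\<close> on.\<close>
  define X where "X = product_topology (\<lambda>_::nat. discrete_topology (UNIV :: 'a set)) UNIV"
  define F where "F c = fls_shift (- d) (fps_to_fls (Abs_fps c))" for c :: "nat \<Rightarrow> 'a"
  have F_nth: "F c $$ i = (if i < d then 0 else c (nat (i - d)))" for c i
    by (simp add: F_def)
  have "continuous_map X euclidean F"
    unfolding continuous_map_def
  proof (intro conjI allI impI)
    fix U :: "'a fls set" assume "openin euclidean U"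
    then have U: "open U" by simp
    show "openin X {c \<in> topspace X. F c \<in> U}"
    proof (subst openin_subopen, safe)
      fix c assume "F c \<in> U"
      then obtain N where N: "\<And>y. (\<forall>i<N. y $$ i = F c $$ i) \<Longrightarrow> y \<in> U"
        using U unfolding open_fls_iff by blast
      \<comment> \<open>The coefficients of \<open>F c\<close> below \<open>N\<close> depend on the
        first \<open>N - d\<close> entries of \<open>c\<close> only, so a cylinder fixing these is
        mapped into \<open>U\<close>.\<close>
      define S where "S j = (if j < nat (N - d) then {c j} else UNIV)" for j
      have "{j. S j \<noteq> UNIV} \<subseteq> {..<nat (N - d)}"
        by (auto simp: S_def)
      then have "openin X (Pi\<^sub>E UNIV S)"
        unfolding X_def openin_PiE_gen by (auto intro: finite_subset)
      moreover have "F c' \<in> U" if "c' \<in> Pi\<^sub>E UNIV S" for c'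
      proof (rule N, safe)
        fix i assume "i < N"
        have "c' (nat (i - d)) = c (nat (i - d))" if "\<not> i < d"
          using that \<open>i < N\<close> PiE_mem[OF \<open>c' \<in> Pi\<^sub>E UNIV S\<close>, of "nat (i - d)"]
          by (simp add: S_def split: if_splits)
        then show "F c' $$ i = F c $$ i" by (simp add: F_nth)
      qed
      moreover have "c \<in> Pi\<^sub>E UNIV S"
        by (simp add: S_def PiE_UNIV_domain)
      ultimately show "\<exists>T. openin X T \<and> c \<in> T \<and> T \<subseteq> {c \<in> topspace X. F c \<in> U}"
        by (intro exI[of _ "Pi\<^sub>E UNIV S"]) (auto simp: X_def)
    qed
  qed auto
  moreover have "compact_space X"
    by (simp add: X_def compact_space_product_topology compact_space_discrete_topology)
  ultimately have "compactin euclidean (F ` topspace X)"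
    unfolding compact_space_def by (rule image_compactin[rotated])
  moreover have "F ` topspace X = {f. \<forall>i<d. f $$ i = 0}"
  proof safe
    fix f :: "'a fls" assume "\<forall>i<d. f $$ i = 0"
    then have "f = F (\<lambda>j. f $$ (d + int j))"
      by (intro fls_eqI) (simp add: F_nth)
    then show "f \<in> F ` topspace X"
      by (auto simp: X_def)
  qed (simp add: F_nth)
  ultimately show ?thesis
    by simp
qed

lemma locally_compact_space_fls:
  "locally_compact_space (euclidean :: 'a::{finite,group_add} fls topology)"
  unfolding locally_compact_space_def
proof
  fix x :: "'a fls"
  \<comment> \<open>This set is both open and compact, so it serves as the neighbourhood and as the
    compact set containing it.\<close>
  define K where "K = {f :: 'a fls. \<forall>i<fls_subdegree x. f $$ i = 0}"
  have "open K"
    unfolding open_fls_iff K_def by (intro ballI exI[of _ "fls_subdegree x"]) auto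
  moreover have "compact K"
    unfolding K_def by (rule compact_fls_vanishing_below)
  moreover have "x \<in> K"
    by (simp add: K_def)
  ultimately show "\<exists>U K. openin euclidean U \<and> compactin euclidean K \<and> x \<in> U \<and> U \<subseteq> K"
    by auto
qed

section \<open>The cocycles\<close>

lemma omega_nth [simp]: "omega n x y $$ i = x $$ i * y $$ (i + int n)"
  by transfer simp

text \<open>For \<open>n > K\<close> the factor \<open>x $$ (i - int n)\<close> vanishes, so the
  series is finite in each coefficient. Leaving \<open>K\<close> free allows a common truncation for
  several first arguments.\<close>

lemma eta_nth:
  fixes x y :: "'p::prime_card laurent"
  assumes K: "\<forall>j<i - int K. x $$ j = 0"
  shows "eta s (x, y) $$ i = (\<Sum>n=1..K. of_nat (s n) * x $$ (i - int n) * y $$ (i + int n))"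
proof -
  define c where "c i n = of_nat (s n) * x $$ (i - int n) * y $$ (i + int n)" for i n
  \<comment> \<open>Any two admissible truncations agree, since the terms in only one of the sums
    contain a vanishing coefficient of \<open>x\<close>.\<close>
  have c_eq: "(\<Sum>n=1..M. c i n) = (\<Sum>n=1..M'. c i n)"
    if "\<And>j. j < i - int M \<Longrightarrow> x $$ j = 0" "\<And>j. j < i - int M' \<Longrightarrow> x $$ j = 0" for i M M'
    by (rule sum.mono_neutral_cong) (use that in \<open>auto simp: c_def\<close>)
  define d where "d = fls_subdegree x"
  \<comment> \<open>The candidate for the sum of the series. For \<open>i < d\<close> the range is
    empty, so \<open>e\<close> is indeed a Laurent series.\<close>
  define e where "e = Abs_fls (\<lambda>i. \<Sum>n=1..nat (i - d). c i n)"
  have e_nth: "e $$ i = (\<Sum>n=1..nat (i - d). c i n)" for i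
    unfolding e_def by (rule nth_Abs_fls_lower_bound[of d]) simp
  have e_eq: "e $$ i = (\<Sum>n=1..M. c i n)" if "\<And>j. j < i - int M \<Longrightarrow> x $$ j = 0" for i M
    unfolding e_nth by (rule c_eq) (use that in \<open>auto simp: d_def split: if_splits\<close>)
  define T where "T k = (let n = Suc k in
     fls_const (of_nat (s n)) * fls_X ^ n * omega (2 * n) x y)" for k
  \<comment> \<open>Multiplication by the \<open>n\<close>-th power of t turns the index pair
    \<open>i\<close>, \<open>i + 2n\<close> of \<open>omega (2 * n)\<close> into the pair
    \<open>i - n\<close>, \<open>i + n\<close>, symmetric about \<open>i\<close>.\<close>
  have T_nth: "T k $$ i = c i (Suc k)" for k i
    unfolding T_def Let_def c_def mult.assoc fls_X_power_times_conv_shift(1)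
    by (simp add: algebra_simps)
  have "T sums e"
    unfolding sums_def tendsto_fls_iff eventually_sequentially
  proof (intro allI exI impI)
    fix B i M assume M: "nat (B - d) \<le> M" and "i < B"
    have "e $$ i = (\<Sum>n=1..M. c i n)"
      by (rule e_eq) (use M \<open>i < B\<close> in \<open>auto simp: d_def\<close>)
    also have "\<dots> = (\<Sum>k<M. c i (Suc k))"
      by (simp add: sum.atLeast_Suc_atMost_Suc_shift atLeast0AtMost sum.atLeast1_atMost_eq)
    finally show "(\<Sum>k<M. T k) $$ i = e $$ i"
      by (simp add: fls_nth_sum T_nth)
  qed
  then have "eta s (x, y) = e"
    by (simp add: eta_def T_def[abs_def] sums_iff)
  then show ?thesis
    using e_eq[of i K] K by (simp add: c_def)
qed

lemma eta_add_left: "eta s (x + x', y) = eta s (x, y) + eta s (x', y)"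
proof (rule fls_eqI)
  fix i
  \<comment> \<open>The minimum makes one truncation valid for \<open>x\<close>, \<open>x'\<close>
    and \<open>x + x'\<close>.\<close>
  define K where "K = nat (i - min (fls_subdegree x) (fls_subdegree x'))"
  have "x $$ j = 0" "x' $$ j = 0" if "j < i - int K" for j
    using that by (auto simp: K_def split: if_splits)
  then show "eta s (x + x', y) $$ i = (eta s (x, y) + eta s (x', y)) $$ i"
    by (simp add: eta_nth[of i K] algebra_simps sum.distrib)
qed

lemma eta_add_right: "eta s (x, y + y') = eta s (x, y) + eta s (x, y')"
proof (rule fls_eqI)
  fix i
  have "x $$ j = 0" if "j < i - int (nat (i - fls_subdegree x))" for j
    using that by (auto split: if_splits)
  then show "eta s (x, y + y') $$ i = (eta s (x, y) + eta s (x, y')) $$ i"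
    by (simp add: eta_nth[of i "nat (i - fls_subdegree x)"] algebra_simps sum.distrib)
qed

lemma eta_fls_X: "eta s (fls_X * x, fls_X * y) = fls_X * eta s (x, y)"
proof (rule fls_eqI)
  fix i
  \<comment> \<open>The same \<open>K\<close> is admissible for \<open>x\<close> at index
    \<open>i - 1\<close> and for its shift at index \<open>i\<close>.\<close>
  define K where "K = nat (i - 1 - fls_subdegree x)"
  have 1: "\<forall>j<i - 1 - int K. x $$ j = 0"
    by (auto simp: K_def split: if_splits)
  then have 2: "\<forall>j<i - int K. fls_shift (- 1) x $$ j = 0"
    by simp
  show "eta s (fls_X * x, fls_X * y) $$ i = (fls_X * eta s (x, y)) $$ i"
    unfolding fls_X_times_conv_shift(1) fls_shift_nth diff_conv_add_uminus[symmetric]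
      eta_nth[OF 1] eta_nth[OF 2]
    by (simp add: algebra_simps)
qed

lemma continuous_on_eta: "continuous_on UNIV (eta s)"
proof -
  have "(eta s \<longlongrightarrow> eta s (x, y)) (at (x, y))" for x y :: "'a laurent"
    unfolding tendsto_fls_iff
  proof
    fix N
    define K where "K = nat (N - fls_subdegree x)"
    \<comment> \<open>Every index of \<open>x\<close> or \<open>y\<close> entering a coefficient
      below \<open>N\<close> is less than \<open>M\<close>. Agreement below \<open>M\<close> also
      makes \<open>fst z\<close> vanish below \<open>i - int K\<close>, so the truncation
      \<open>K\<close> is valid at \<open>z\<close> as well.\<close>
    define M where "M = max (N + int K) (fls_subdegree x)"
    have "((\<lambda>z. z) \<longlongrightarrow> (x, y)) (at (x, y))"
      by (rule tendsto_ident_at)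
    from tendsto_fst[OF this] tendsto_snd[OF this]
    have "(fst \<longlongrightarrow> x) (at (x, y))" "(snd \<longlongrightarrow> y) (at (x, y))"
      by simp_all
    then have "\<forall>\<^sub>F z in at (x, y). \<forall>i<M. fst z $$ i = x $$ i"
      "\<forall>\<^sub>F z in at (x, y). \<forall>i<M. snd z $$ i = y $$ i"
      unfolding tendsto_fls_iff by blast+
    then show "\<forall>\<^sub>F z in at (x, y). \<forall>i<N. eta s z $$ i = eta s (x, y) $$ i"
    proof eventually_elim
      case (elim z)
      show ?case
      proof safe
        fix i assume i: "i < N"
        have x0: "x $$ j = 0" if "j < i - int K" for j
          using that i by (auto simp: K_def split: if_splits)
        moreover have "fst z $$ j = 0" if "j < i - int K" for j
          using that i elim(1) x0[OF that] by (auto simp: M_def)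
        ultimately have "eta s (fst z, snd z) $$ i = eta s (x, y) $$ i"
          using i elim by (subst (1 2) eta_nth[of i K]) (auto intro!: sum.cong simp: M_def)
        then show "eta s z $$ i = eta s (x, y) $$ i" by simp
      qed
    qed
  qed
  then show ?thesis
    by (auto simp: continuous_on_def)
qed

text \<open>Biadditivity makes the terms of the cocycle identity cancel.\<close>

lemma eta_in_Z2eq_set: "eta s \<in> Z2eq_set"
  by (auto simp: Z2eq_set_def continuous_on_eta eta_fls_X eta_add_left eta_add_right)

section \<open>Values of the cocycles that detect the sequence\<close>

lemma eta_1_fls_X_power:
  assumes "n \<ge> 1"
  shows "eta s (1, fls_X ^ (2 * n)) = fls_const (of_nat (s n)) * fls_X ^ n"
proof (rule fls_eqI)
  fix i
  have *: "\<forall>j<i - int (nat i). (1 :: 'a laurent) $$ j = 0"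
    by (auto split: if_splits)
  have "eta s (1 :: 'a laurent, fls_X ^ (2 * n)) $$ i =
      (\<Sum>m=1..nat i. if m = n then (if i = int n then of_nat (s n) else 0) else 0)"
    \<comment> \<open>A nonzero term requires \<open>i - m = 0\<close> and
      \<open>i + m = 2n\<close>, that is \<open>i = m = n\<close>.\<close>
    unfolding eta_nth[OF *] by (intro sum.cong) auto
  also have "\<dots> = (fls_const (of_nat (s n)) * fls_X ^ n) $$ i"
    using assms by auto
  finally show "eta s (1, fls_X ^ (2 * n)) $$ i = (fls_const (of_nat (s n)) * fls_X ^ n :: 'a laurent) $$ i" .
qed

text \<open>A nonzero term would require \<open>i - m = 2n\<close> and \<open>i + m = 0\<close>,
  hence \<open>m = -n\<close>, whereas \<open>m\<close> starts at 1. This one-sided range is what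
  makes \<open>eta s\<close> asymmetric.\<close>

lemma eta_fls_X_power_1: "eta s (fls_X ^ (2 * n), 1) = 0"
proof (rule fls_eqI)
  fix i
  have *: "\<forall>j<i - int (nat i). (fls_X ^ (2 * n) :: 'a laurent) $$ j = 0"
    by (auto split: if_splits)
  show "eta s (fls_X ^ (2 * n), 1) $$ i = (0 :: 'a laurent) $$ i"
    unfolding eta_nth[OF *] by (auto intro!: sum.neutral)
qed

text \<open>With \<open>k\<close> the order of \<open>v\<close>, the \<open>m\<close>-th term of the
  first coefficient multiplies the entries of \<open>v\<close> at \<open>k + n - m\<close> and
  \<open>k - n + m\<close>. These indices add up to \<open>2k\<close>, so one lies below
  \<open>k\<close> unless \<open>m = n\<close>.\<close>

lemma eta_fls_X_power_mult_nth:
  fixes v :: "'p::prime_card laurent"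
  assumes "n \<ge> 1"
  shows "eta s (v, fls_X ^ (2 * n) * v) $$ (fls_subdegree v + int n) =
      of_nat (s n) * (v $$ fls_subdegree v)\<^sup>2"
    and "eta s (fls_X ^ (2 * n) * v, v) $$ (fls_subdegree v + int n) = 0"
proof -
  define k where "k = fls_subdegree v"
  have *: "\<forall>j<k + int n - int n. v $$ j = 0"
    by (simp add: k_def)
  have "eta s (v, fls_X ^ (2 * n) * v) $$ (k + int n) =
      (\<Sum>m=1..n. if m = n then of_nat (s n) * (v $$ k)\<^sup>2 else 0)"
    unfolding eta_nth[OF *]
    by (intro sum.cong)
       (auto simp: fls_X_power_times_conv_shift k_def power2_eq_square)
  then show "eta s (v, fls_X ^ (2 * n) * v) $$ (fls_subdegree v + int n) =
      of_nat (s n) * (v $$ fls_subdegree v)\<^sup>2"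
    using assms by (simp add: k_def)
  \<comment> \<open>The shifted series starts only at \<open>k + 2n\<close>, so truncation at 0 is
    allowed and the sum is empty.\<close>
  have **: "\<forall>j<k + int n - int 0. (fls_X ^ (2 * n) * v) $$ j = 0"
    by (simp add: fls_X_power_times_conv_shift k_def)
  show "eta s (fls_X ^ (2 * n) * v, v) $$ (fls_subdegree v + int n) = 0"
    using eta_nth[OF **] by (simp add: k_def)
qed

section \<open>Extensions as contraction groups\<close>

text \<open>Equivariance at the origin gives \<open>(1 - fls_X) * \<omega> (0, 0) = 0\<close>, and
  \<open>1 - fls_X\<close> is nonzero. The cocycle identity with two zero arguments reduces the
  other values to this one.\<close>

lemma Z2eq_set_normalized:
  assumes "\<omega> \<in> Z2eq_set"
  shows "\<omega> (0, y) = 0" "\<omega> (x, 0) = 0"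
proof -
  have coc: "\<omega> (y, z) - \<omega> (x + y, z) + \<omega> (x, y + z) - \<omega> (x, y) = 0" for x y z
    using assms by (simp add: Z2eq_set_def)
  have "\<omega> (fls_X * 0, fls_X * 0) = fls_X * \<omega> (0, 0)"
    using assms unfolding Z2eq_set_def by blast
  then have "(1 - fls_X) * \<omega> (0, 0) = 0"
    by (simp add: algebra_simps)
  moreover have "(1 - fls_X :: 'a laurent) $$ 0 \<noteq> 0 $$ 0"
    by simp
  ultimately have "\<omega> (0, 0) = 0"
    by (metis mult_eq_0_iff)
  then show "\<omega> (0, y) = 0" "\<omega> (x, 0) = 0"
    using coc[of 0 y 0] coc[of 0 0 y] coc[of 0 0 x] coc[of x 0 0] by simp_all
qed

lemma ext_group_simps:
  "carrier (ext_group \<omega>) = UNIV"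
  "(a1, b1) \<otimes>\<^bsub>ext_group \<omega>\<^esub> (a2, b2) = (a1 + a2 + \<omega> (b1, b2), b1 + b2)"
  "\<one>\<^bsub>ext_group \<omega>\<^esub> = (0, 0)"
  "gtop (ext_group \<omega>) = euclidean"
  by (simp_all add: ext_group_def)

lemma group_ext_group:
  assumes "\<omega> \<in> Z2eq_set"
  shows "group (ext_group \<omega>)"
proof (rule groupI; unfold ext_group_simps(1,3))
  fix u v w :: "'a laurent \<times> 'a laurent"
  \<comment> \<open>The cocycle identity is exactly associativity in the first component.\<close>
  have "\<omega> (snd v, snd w) - \<omega> (snd u + snd v, snd w) + \<omega> (snd u, snd v + snd w) - \<omega> (snd u, snd v) = 0"
    using assms by (simp add: Z2eq_set_def)
  then show "u \<otimes>\<^bsub>ext_group \<omega>\<^esub> v \<otimes>\<^bsub>ext_group \<omega>\<^esub> w = u \<otimes>\<^bsub>ext_group \<omega>\<^esub> (v \<otimes>\<^bsub>ext_group \<omega>\<^esub> w)"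
    by (cases u; cases v; cases w) (simp add: ext_group_simps algebra_simps)
  show "(0, 0) \<otimes>\<^bsub>ext_group \<omega>\<^esub> u = u"
    by (cases u) (simp add: ext_group_simps Z2eq_set_normalized[OF assms])
  obtain a b where u: "u = (a, b)" by (cases u)
  have "(- a - \<omega> (- b, b), - b) \<otimes>\<^bsub>ext_group \<omega>\<^esub> u = (0, 0)"
    by (simp add: u ext_group_simps)
  then show "\<exists>v\<in>UNIV. v \<otimes>\<^bsub>ext_group \<omega>\<^esub> u = (0, 0)"
    by blast
qed auto

lemma inv_ext_group:
  assumes "\<omega> \<in> Z2eq_set"
  shows "inv\<^bsub>ext_group \<omega>\<^esub> (a, b) = (- a - \<omega> (- b, b), - b)"
  by (rule group.inv_equality[OF group_ext_group[OF assms]]) (simp_all add: ext_group_simps)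

lemma topological_group_ext_group:
  assumes "\<omega> \<in> Z2eq_set"
  shows "topological_group (ext_group \<omega>)"
proof -
  have cont: "continuous_on UNIV \<omega>"
    using assms by (simp add: Z2eq_set_def)
  have "continuous_on UNIV (\<lambda>(u, v). u \<otimes>\<^bsub>ext_group \<omega>\<^esub> v)"
    unfolding ext_group_def case_prod_unfold
    by (auto intro!: continuous_intros continuous_on_compose2[OF cont])
  moreover have "(\<lambda>u. inv\<^bsub>ext_group \<omega>\<^esub> u) = (\<lambda>u. (- fst u - \<omega> (- snd u, snd u), - snd u))"
    by (auto simp: inv_ext_group[OF assms])
  then have "continuous_on UNIV (\<lambda>u. inv\<^bsub>ext_group \<omega>\<^esub> u)"
    by (auto intro!: continuous_intros continuous_on_compose2[OF cont])
  ultimately show ?thesis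
    by (simp add: topological_group_def group_ext_group[OF assms] ext_group_simps)
qed

lemma map_prod_\<alpha>_power: "(map_prod \<alpha> \<alpha> ^^ n) (a, b) = (fls_X ^ n * a, fls_X ^ n * b)"
  by (induction n) (simp_all add: \<alpha>_def mult.assoc)

lemma \<alpha>_conv_shift: "\<alpha> = fls_shift (- 1)"
  by (auto simp: \<alpha>_def fls_X_times_conv_shift)

lemma fls_X_power_mult_tendsto_0: "(\<lambda>n. fls_X ^ n * f) \<longlonglongrightarrow> (0 :: 'p::prime_card laurent)"
  unfolding tendsto_fls_iff eventually_sequentially
proof (intro allI exI impI)
  fix N i n assume "nat (N - fls_subdegree f) \<le> n" "i < N"
  then show "(fls_X ^ n * f) $$ i = 0 $$ i"
    by (simp add: fls_X_power_times_conv_shift)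
qed

lemma contraction_group_ext_group:
  assumes "\<omega> \<in> Z2eq_set"
  shows "contraction_group (ext_group \<omega>, map_prod \<alpha> \<alpha>)"
proof -
  let ?\<alpha> = "map_prod \<alpha> \<alpha> :: 'a laurent \<times> 'a laurent \<Rightarrow> _"
  \<comment> \<open>Componentwise division by t, the continuous inverse of
    \<open>?\<alpha>\<close>.\<close>
  let ?\<beta> = "map_prod (fls_shift 1) (fls_shift 1) :: 'a laurent \<times> 'a laurent \<Rightarrow> _"
  have equiv: "\<omega> (fls_X * x, fls_X * y) = fls_X * \<omega> (x, y)" for x y
    using assms by (simp add: Z2eq_set_def)
  have inv: "?\<beta> (?\<alpha> u) = u" "?\<alpha> (?\<beta> u) = u" for u
    by (cases u; simp add: \<alpha>_conv_shift)+
  then have "bij ?\<alpha>"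
    by (metis bijI')
  moreover have "?\<alpha> \<in> hom (ext_group \<omega>) (ext_group \<omega>)"
    by (auto simp: hom_def ext_group_simps \<alpha>_def equiv distrib_left)
  ultimately have "?\<alpha> \<in> iso (ext_group \<omega>) (ext_group \<omega>)"
    by (simp add: iso_def ext_group_simps)
  moreover have "continuous_on UNIV ?\<alpha>" "continuous_on UNIV ?\<beta>"
    by (auto simp: \<alpha>_conv_shift map_prod_def case_prod_unfold intro!: continuous_intros)
  then have "homeomorphic_maps euclidean euclidean ?\<alpha> ?\<beta>"
    by (simp add: homeomorphic_maps_def inv)
  then have "homeomorphic_map euclidean euclidean ?\<alpha>"
    using homeomorphic_maps_map by blast
  moreover have "(\<lambda>n. (?\<alpha> ^^ n) u) \<longlonglongrightarrow> (0, 0)" for u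
    by (cases u) (auto simp: map_prod_\<alpha>_power intro!: tendsto_Pair fls_X_power_mult_tendsto_0)
  moreover have "Hausdorff_space (euclidean :: ('a laurent \<times> 'a laurent) topology)"
    by simp
  moreover have "locally_compact_space (euclidean :: ('a laurent \<times> 'a laurent) topology)"
    using locally_compact_space_prod_topology[of "euclidean :: 'a laurent topology"
        "euclidean :: 'a laurent topology"] locally_compact_space_fls[where 'a = "'a mod_ring"]
    by simp
  ultimately show ?thesis
    by (simp add: contraction_group_def locally_compact_group_def topgroup_iso_def
        topological_group_ext_group[OF assms] ext_group_simps)
qed

section \<open>Distinguishing the extensions\<close>

text \<open>Reduction modulo p is faithful on the values 0 and 1.\<close>

lemma of_nat_binary_eq_0_iff:
  assumes "s \<in> binary_seqs" "n \<ge> 1"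
  shows "of_nat (s n) = (0 :: 'p::prime_card mod_ring) \<longleftrightarrow> s n = 0"
proof -
  have "s n \<in> {0, 1}"
    using assms by (auto simp: binary_seqs_def)
  then show ?thesis by auto
qed

text \<open>Extensionality of \<open>binary_seqs\<close> fixes the value at index 0.\<close>

lemma binary_seqs_eqI:
  assumes "r \<in> binary_seqs" "s \<in> binary_seqs" "\<And>n. n \<ge> 1 \<Longrightarrow> r n = 0 \<longleftrightarrow> s n = 0"
  shows "r = s"
proof (rule PiE_ext)
  show "r \<in> {1..} \<rightarrow>\<^sub>E {0, 1}" "s \<in> {1..} \<rightarrow>\<^sub>E {0, 1}"
    using assms by (simp_all add: binary_seqs_def)
  fix n :: nat assume n: "n \<in> {1..}"
  then have "r n \<in> {0, 1}" "s n \<in> {0, 1}"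
    using assms by (auto simp: binary_seqs_def)
  then show "r n = s n"
    using assms(3)[of n] n by auto
qed

lemma ext_group_commute_iff:
  "u \<otimes>\<^bsub>ext_group \<omega>\<^esub> v = v \<otimes>\<^bsub>ext_group \<omega>\<^esub> u \<longleftrightarrow> \<omega> (snd u, snd v) = \<omega> (snd v, snd u)"
  by (cases u; cases v) (auto simp: ext_group_simps add.commute)

text \<open>One implication suffices: applying the lemma to the inverse map, with \<open>r\<close>
  and \<open>s\<close> exchanged, yields the converse.\<close>

lemma equivariant_iso_zero_transfer:
  fixes \<psi> :: "'p::prime_card laurent \<times> 'p laurent \<Rightarrow> 'p laurent \<times> 'p laurent"
  assumes r: "r \<in> binary_seqs"
    and bij: "bij \<psi>"
    and hom: "\<And>u v. \<psi> (u \<otimes>\<^bsub>ext_group (eta s)\<^esub> v) = \<psi> u \<otimes>\<^bsub>ext_group (eta r)\<^esub> \<psi> v"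
    and equiv: "\<And>u. map_prod \<alpha> \<alpha> (\<psi> u) = \<psi> (map_prod \<alpha> \<alpha> u)"
    and n: "n \<ge> 1" and sn: "s n = 0"
  shows "r n = 0"
proof (rule ccontr)
  assume rn: "r n \<noteq> 0"
  have comm: "eta s (snd u, snd v) = eta s (snd v, snd u) \<longleftrightarrow>
      eta r (snd (\<psi> u), snd (\<psi> v)) = eta r (snd (\<psi> v), snd (\<psi> u))" for u v
    using bij unfolding ext_group_commute_iff[symmetric] hom[symmetric]
    by (simp add: bij_is_inj inj_eq)
  obtain c w where cw: "\<psi> (0, 1) = (c, w)" by fastforce
  have "\<psi> ((map_prod \<alpha> \<alpha> ^^ k) u) = (map_prod \<alpha> \<alpha> ^^ k) (\<psi> u)" for k u
    by (induction k) (simp_all add: equiv[symmetric])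
  from this[of "2 * n" "(0, 1)"] have "\<psi> (0, fls_X ^ (2 * n)) = (fls_X ^ (2 * n) * c, fls_X ^ (2 * n) * w)"
    by (simp add: map_prod_\<alpha>_power cw)
  moreover have "eta s (1 :: 'p laurent, fls_X ^ (2 * n)) = eta s (fls_X ^ (2 * n), 1)"
    using n by (simp add: eta_1_fls_X_power eta_fls_X_power_1 sn)
  ultimately have "eta r (w, fls_X ^ (2 * n) * w) = eta r (fls_X ^ (2 * n) * w, w)"
    using comm[of "(0, 1)" "(0, fls_X ^ (2 * n))"] by (simp add: cw)
  \<comment> \<open>Compare the coefficients at \<open>fls_subdegree w + int n\<close>, which is
    zero on the right-hand side.\<close>
  then have "of_nat (r n) * (w $$ fls_subdegree w)\<^sup>2 = 0"
    using eta_fls_X_power_mult_nth[OF n, of _ w] by metis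
  then have w0: "w = 0"
    using of_nat_binary_eq_0_iff[OF r n, where 'p='p] rn by (auto simp: nth_fls_subdegree_zero_iff)
  \<comment> \<open>Now \<open>(0, 1)\<close> is central, being mapped into the first factor; this forces \<open>s = 0\<close>.\<close>
  have eta_0: "eta r (0, y) = 0" "eta r (y, 0) = 0" for y :: "'p laurent"
    by (simp_all add: Z2eq_set_normalized eta_in_Z2eq_set)
  have "of_nat (s m) = (0 :: 'p mod_ring)" if m: "m \<ge> 1" for m
  proof -
    have "eta s (1 :: 'p laurent, fls_X ^ (2 * m)) = eta s (fls_X ^ (2 * m), 1)"
      using comm[of "(0, 1)" "(0, fls_X ^ (2 * m))"] by (simp add: cw w0 eta_0)
    then have "fls_const (of_nat (s m)) * fls_X ^ m = (0 :: 'p laurent)"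
      using m by (simp add: eta_1_fls_X_power eta_fls_X_power_1)
    then show ?thesis by (simp add: fls_const_nonzero)
  qed
  then have "eta s z $$ i = 0" for z :: "'p laurent \<times> 'p laurent" and i
    using eta_nth[of i "nat (i - fls_subdegree (fst z))" "fst z" s "snd z"] by simp
  then have "eta s z = 0" for z :: "'p laurent \<times> 'p laurent"
    by (intro fls_eqI) simp
  \<comment> \<open>As \<open>eta s\<close> vanishes, its extension is abelian; hence all images
    under \<open>\<psi>\<close> commute, and by surjectivity so does the whole target group.\<close>
  then have "eta r (snd (\<psi> u), snd (\<psi> v)) = eta r (snd (\<psi> v), snd (\<psi> u))" for u v
    using comm[of u v] by simp
  then have "eta r (snd u, snd v) = eta r (snd v, snd u)" for u v :: "'p laurent \<times> 'p laurent"
    using bij by (metis bij_pointE)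
  from this[of "(0, 1)" "(0, fls_X ^ (2 * n))"]
  have "fls_const (of_nat (r n)) * fls_X ^ n = (0 :: 'p laurent)"
    using n by (simp add: eta_1_fls_X_power eta_fls_X_power_1)
  then have "of_nat (r n) = (0 :: 'p mod_ring)"
    by (simp add: fls_const_nonzero)
  then show False
    using rn of_nat_binary_eq_0_iff[OF r n, where 'p='p] by simp
qed

lemma equivariant_iso_imp_eq:
  fixes \<psi> :: "'p::prime_card laurent \<times> 'p laurent \<Rightarrow> 'p laurent \<times> 'p laurent"
  assumes r: "r \<in> binary_seqs" and s: "s \<in> binary_seqs"
    and \<psi>: "\<psi> \<in> topgroup_iso (ext_group (eta s)) (ext_group (eta r))"
    and equiv: "\<And>u. map_prod \<alpha> \<alpha> (\<psi> u) = \<psi> (map_prod \<alpha> \<alpha> u)"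
  shows "r = s"
proof -
  have bij: "bij \<psi>"
    and hom: "\<psi> (u \<otimes>\<^bsub>ext_group (eta s)\<^esub> v) = \<psi> u \<otimes>\<^bsub>ext_group (eta r)\<^esub> \<psi> v" for u v
    using \<psi> by (auto simp: topgroup_iso_def iso_def ext_group_simps(1) intro!: hom_mult)
  \<comment> \<open>The inverse bijection is again multiplicative and equivariant.\<close>
  define \<phi> where "\<phi> = inv_into UNIV \<psi>"
  have bij': "bij \<phi>"
    unfolding \<phi>_def using bij by (rule bij_imp_bij_inv)
  have inv: "\<psi> (\<phi> u) = u" "\<phi> (\<psi> u) = u" for u
    using bij by (simp_all add: \<phi>_def bij_is_surj surj_f_inv_f bij_is_inj)
  have hom': "\<phi> (u \<otimes>\<^bsub>ext_group (eta r)\<^esub> v) = \<phi> u \<otimes>\<^bsub>ext_group (eta s)\<^esub> \<phi> v" for u v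
    by (metis hom inv)
  have equiv': "map_prod \<alpha> \<alpha> (\<phi> u) = \<phi> (map_prod \<alpha> \<alpha> u)" for u
    by (metis equiv inv)
  show ?thesis
    using equivariant_iso_zero_transfer[OF r bij hom equiv]
      equivariant_iso_zero_transfer[OF s bij' hom' equiv']
    by (intro binary_seqs_eqI[OF r s]) blast
qed

section \<open>Cohomology classes\<close>

lemma H2eq_class_eta_eq_imp_eq:
  assumes r: "r \<in> binary_seqs" and s: "s \<in> binary_seqs"
    and eq: "H2eq_class (eta r :: 'p::prime_card laurent \<times> 'p laurent \<Rightarrow> 'p laurent) = H2eq_class (eta s)"
  shows "r = s"
proof (rule binary_seqs_eqI[OF r s])
  fix n :: nat assume n: "n \<ge> 1"
  have "(\<lambda>_. 0) \<in> (B2eq :: ('p laurent \<times> 'p laurent \<Rightarrow> 'p laurent) set)"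
    unfolding B2eq_def by (intro CollectI exI[of _ "\<lambda>_. 0"]) auto
  then have "eta r \<in> H2eq_class (eta r :: 'p laurent \<times> 'p laurent \<Rightarrow> 'p laurent)"
    by (force simp: H2eq_class_def r_coset_def Z2eq_def)
  then obtain b where b: "b \<in> (B2eq :: ('p laurent \<times> 'p laurent \<Rightarrow> 'p laurent) set)"
      and rs: "\<And>z. eta r z = b z + eta s z"
    unfolding eq by (auto simp: H2eq_class_def r_coset_def Z2eq_def fun_eq_iff)
  have "b (x, y) = b (y, x)" for x y
    using b by (auto simp: B2eq_def add.commute)
  \<comment> \<open>At \<open>(fls_X ^ (2 * n), 1)\<close> both cocycles vanish, so \<open>b\<close>
    does too. By symmetry \<open>b\<close> vanishes at the swapped pair, where the cocycles show
    their \<open>n\<close>-th entries.\<close>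
  then have "fls_const (of_nat (r n)) * fls_X ^ n = fls_const (of_nat (s n)) * (fls_X ^ n :: 'p laurent)"
    using rs[of "(1, fls_X ^ (2 * n))"] rs[of "(fls_X ^ (2 * n), 1)"] n
    by (simp add: eta_1_fls_X_power eta_fls_X_power_1)
  then have "fls_const (of_nat (r n)) = (fls_const (of_nat (s n)) :: 'p laurent)"
    by simp
  then have "(of_nat (r n) :: 'p mod_ring) = of_nat (s n)"
    by (metis fls_const_nth)
  then show "r n = 0 \<longleftrightarrow> s n = 0"
    using of_nat_binary_eq_0_iff[OF r n, where 'p='p] of_nat_binary_eq_0_iff[OF s n, where 'p='p]
    by simp
qed

theorem theorem8p1:
  shows "(\<forall>s\<in>binary_seqs.
            contraction_group
              (ext_group (eta s :: 'p::prime_card laurent \<times> 'p laurent \<Rightarrow> 'p laurent),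
               map_prod \<alpha> \<alpha>))
       \<and> pairwise
            (\<lambda>s r. \<not> contraction_isomorphic
               (ext_group (eta s :: 'p laurent \<times> 'p laurent \<Rightarrow> 'p laurent), map_prod \<alpha> \<alpha>)
               (ext_group (eta r :: 'p laurent \<times> 'p laurent \<Rightarrow> 'p laurent), map_prod \<alpha> \<alpha>))
            binary_seqs
       \<and> (\<forall>r\<in>binary_seqs. \<forall>s\<in>binary_seqs.
            (\<exists>\<psi> :: 'p laurent \<times> 'p laurent \<Rightarrow> 'p laurent \<times> 'p laurent.
               \<psi> \<in> topgroup_iso (ext_group (eta s)) (ext_group (eta r)) \<and>
               map_prod \<alpha> \<alpha> \<circ> \<psi> = \<psi> \<circ> map_prod \<alpha> \<alpha>)
            \<longrightarrow> r = s)
       \<and> (\<lambda>s. H2eq_class (eta s :: 'p laurent \<times> 'p laurent \<Rightarrow> 'p laurent))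
            \<in> binary_seqs \<rightarrow> carrier H2eq
       \<and> inj_on (\<lambda>s. H2eq_class (eta s :: 'p laurent \<times> 'p laurent \<Rightarrow> 'p laurent)) binary_seqs"
proof (intro conjI)
  let ?eta = "eta :: (nat \<Rightarrow> nat) \<Rightarrow> 'p laurent \<times> 'p laurent \<Rightarrow> 'p laurent"
  show "\<forall>s\<in>binary_seqs. contraction_group (ext_group (?eta s), map_prod \<alpha> \<alpha>)"
    by (simp add: contraction_group_ext_group eta_in_Z2eq_set)
  show "pairwise (\<lambda>s r. \<not> contraction_isomorphic (ext_group (?eta s), map_prod \<alpha> \<alpha>)
      (ext_group (?eta r), map_prod \<alpha> \<alpha>)) binary_seqs"
  proof (rule pairwiseI, rule notI)
    fix s r :: "nat \<Rightarrow> nat"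
    assume sr: "s \<in> binary_seqs" "r \<in> binary_seqs" "s \<noteq> r"
      and "contraction_isomorphic (ext_group (?eta s), map_prod \<alpha> \<alpha>)
        (ext_group (?eta r), map_prod \<alpha> \<alpha>)"
    then obtain \<psi> where "\<psi> \<in> topgroup_iso (ext_group (?eta s)) (ext_group (?eta r))"
        "\<And>u. map_prod \<alpha> \<alpha> (\<psi> u) = \<psi> (map_prod \<alpha> \<alpha> u)"
      by (auto simp: contraction_isomorphic_def contraction_group_isos_def ext_group_simps(1))
    with sr show False
      using equivariant_iso_imp_eq by blast
  qed
  show "\<forall>r\<in>binary_seqs. \<forall>s\<in>binary_seqs.
      (\<exists>\<psi>. \<psi> \<in> topgroup_iso (ext_group (?eta s)) (ext_group (?eta r)) \<and>
        map_prod \<alpha> \<alpha> \<circ> \<psi> = \<psi> \<circ> map_prod \<alpha> \<alpha>) \<longrightarrow> r = s"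
    using equivariant_iso_imp_eq by (metis comp_apply)
  \<comment> \<open>The quotient's carrier consists of all cosets of \<open>B2eq\<close> by elements
    of \<open>Z2eq_set\<close>, so membership of \<open>eta s\<close> is all there is to
    check.\<close>
  show "(\<lambda>s. H2eq_class (?eta s)) \<in> binary_seqs \<rightarrow> carrier H2eq"
    by (auto simp: H2eq_def FactGroup_def RCOSETS_def H2eq_class_def Z2eq_def
        intro!: eta_in_Z2eq_set)
  show "inj_on (\<lambda>s. H2eq_class (?eta s)) binary_seqs"
    by (rule inj_onI) (rule H2eq_class_eta_eq_imp_eq)
qed

end
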